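(* Let $p\in(-\infty,-1]\cup[0,\infty)$. The two-sided inequality $$2\,\frac{(3p+1)\left(\sqrt{1+x}-\sqrt{1-x}\right)+2x}{4p+(p+3)\left(\sqrt{1+x}+\sqrt{1-x}\right)}<\arcsin x<\frac{2}{\sigma_p}\,\frac{(3p+1)\left(\sqrt{1+x}-\sqrt{1-x}\right)+2x}{4p+(p+3)\left(\sqrt{1+x}+\sqrt{1-x}\right)}$$ holds for all $x\in(0,1)$ if and only if $p\in(-\infty,-1]\cup[9,\infty)$, where $$\sigma_p=\frac4\pi\cdot\frac{3p+\sqrt2+1}{(2\sqrt2+1)p+3}$$ is the best constant. Moreover, for each $x\in(0,1)$, the lower and upper bounds in this two-sided inequality are, respectively, decreasing and increasing in $p$ on each of the intervals $(-\infty,-1]$ and $(0,\infty)$. The two-sided inequality is reversed (both inequality signs reversed, for all $x\in(0,1)$) if $p\in[0,p_1]$, where $$p_1=\frac{2\sqrt{6\pi+1}+3\pi-2}{12-3\pi}\approx 6.343.$$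
   Context: "Best constant" means that, for $p\in(-\infty,-1]\cup[9,\infty)$, $\sigma_p$ in the upper bound cannot be replaced by a larger constant (with the inequality still valid for all $x\in(0,1)$). *)

theory Defs
  imports Complex_Main
begin

definition arcsin_quot :: "real \<Rightarrow> real \<Rightarrow> real" where
  "arcsin_quot p x =
     ((3 * p + 1) * (sqrt (1 + x) - sqrt (1 - x)) + 2 * x)
       / (4 * p + (p + 3) * (sqrt (1 + x) + sqrt (1 - x)))"

definition sigma :: "real \<Rightarrow> real" where
  "sigma p = 4 / pi * ((3 * p + sqrt 2 + 1) / ((2 * sqrt 2 + 1) * p + 3))"

definition p1 :: real where
  "p1 = (2 * sqrt (6 * pi + 1) + 3 * pi - 2) / (12 - 3 * pi)"

end

theory Submission
  imports Defs "HOL-Analysis.Complex_Transcendental"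
begin

text \<open>
  Put \<open>x = sin (2 t)\<close> with \<open>0 < t < pi / 4\<close>, so that
  \<open>sqrt (1 \<plusminus> x) = cos t \<plusminus> sin t\<close>. With \<open>c = cos t\<close> the quotient of the theorem becomes
  \<open>H p t = sin t * (3 p + 1 + 2 c) / (2 p + (p + 3) c)\<close>, the constant \<open>sigma p\<close> is
  \<open>H p (pi / 4) / (pi / 4)\<close>, and the two bounds say \<open>H p t < t\<close> and
  \<open>t / (pi / 4) < H p t / H p (pi / 4)\<close>. Thus the second bound is an equality at the end point
  \<open>t = pi / 4\<close>, which makes \<open>sigma p\<close> the best constant.

  Dependence on \<open>p\<close>. Up to the factor \<open>sin t\<close>, \<open>H\<close> is a Moebius function of \<open>p\<close>, and its cross
  differences are \<open>2 (q - p) (1 - c)^2\<close> (lemma \<open>quot_cross\<close>), a square times a factor free of \<open>t\<close>.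
  Its sign gives monotonicity of the lower bound; that \<open>(1 - c)^2\<close> over the product of a
  denominator and a numerator shrinks in absolute value as \<open>c\<close> grows gives monotonicity of the
  upper bound.
  The parameter really moves on a projective line: passing from \<open>p > 0\<close> through infinity to
  \<open>p \<le> -1\<close> continues the same monotone motion (the \<open>wrap\<close> lemmas). Therefore all \<open>p\<close> in
  \<open>(-\<infinity>, -1] \<union> [9, \<infinity>)\<close> inherit both bounds from the single value \<open>p = 9\<close>.

  Dependence on \<open>t\<close>. The derivative of \<open>H p\<close> is
  \<open>1 + (1 - c)^2 (2 (p + 3) c - p^2 + 6 p + 3) / (2 p + (p + 3) c)^2\<close>. The linear factor equals
  \<open>(9 - p) (p + 1)\<close> at \<open>c = 1\<close>; so for \<open>0 \<le> p < 9\<close> the derivative exceeds 1 near \<open>t = 0\<close> and the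
  lower bound fails there. At \<open>p = 9\<close> the derivative is below 1 and decreasing in \<open>t\<close>: \<open>H 9\<close> is
  concave, lies below the diagonal, and its chord slopes decrease, which are the two bounds.
  If \<open>p^2 \<le> 6 p + 3\<close>, in particular if \<open>0 \<le> p \<le> p1\<close>, the derivative exceeds 1 and increases in
  \<open>t\<close>: \<open>H p\<close> is convex, and both inequalities are reversed.
\<close>

section \<open>The quotient as a function of the cosine\<close>

definition quot_num :: "real \<Rightarrow> real \<Rightarrow> real" where
  "quot_num p c = 3 * p + 1 + 2 * c"

definition quot_den :: "real \<Rightarrow> real \<Rightarrow> real" where
  "quot_den p c = 2 * p + (p + 3) * c"

definition cos_quot :: "real \<Rightarrow> real \<Rightarrow> real" where
  "cos_quot p c = quot_num p c / quot_den p c"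

definition half_quot :: "real \<Rightarrow> real \<Rightarrow> real" where
  "half_quot p t = sin t * cos_quot p (cos t)"

definition normalized_quot :: "real \<Rightarrow> real \<Rightarrow> real" where
  "normalized_quot p t = half_quot p t / half_quot p (pi / 4)"

lemma quot_pos:
  assumes "0 \<le> p" "0 < c"
  shows "0 < quot_num p c" "0 < quot_den p c"
proof -
  show "0 < quot_num p c" using assms by (simp add: quot_num_def)
  have "0 < (p + 3) * c" using assms by simp
  then show "0 < quot_den p c" using assms unfolding quot_den_def by linarith
qed

lemma quot_neg:
  assumes "p \<le> -1" "0 < c" "c < 1"
  shows "quot_num p c < 0" "quot_den p c < 0"
proof -
  show "quot_num p c < 0" using assms by (simp add: quot_num_def)
  have "(p + 1) * (2 + c) \<le> 0" using assms by (simp add: mult_nonpos_nonneg)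
  then show "quot_den p c < 0" using assms by (simp add: quot_den_def algebra_simps)
qed

lemma cos_quot_pos:
  assumes "p \<le> -1 \<or> 0 \<le> p" "0 < c" "c < 1"
  shows "0 < cos_quot p c"
  using assms quot_pos[of p c] quot_neg[of p c] by (auto simp: cos_quot_def zero_less_divide_iff)

text \<open>
  Both factors are affine in the parameter, so the cross difference is \<open>q - p\<close> times a polynomial
  in \<open>c\<close>; that this polynomial has a double root at 1 drives all comparisons between parameters.
\<close>

lemma quot_cross:
  "quot_num p c * quot_den q c - quot_num q c * quot_den p c = 2 * (q - p) * (1 - c)\<^sup>2"
  unfolding quot_num_def quot_den_def by (simp add: algebra_simps power2_eq_square)

text \<open>
  In this form the dependence of the ratio on \<open>c\<close> sits in one fraction, so comparing
  ratios at two points reduces to the monotonicity of that fraction.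
\<close>

lemma cos_quot_ratio:
  assumes "quot_den p c \<noteq> 0" "quot_den q c \<noteq> 0" "quot_num q c \<noteq> 0"
  shows "cos_quot p c / cos_quot q c
           = 1 + 2 * (q - p) * ((1 - c)\<^sup>2 / (quot_den p c * quot_num q c))"
proof -
  have "cos_quot p c / cos_quot q c
          = (quot_num p c * quot_den q c) / (quot_den p c * quot_num q c)"
    by (simp add: cos_quot_def)
  also have "quot_num p c * quot_den q c
               = quot_den p c * quot_num q c + 2 * (q - p) * (1 - c)\<^sup>2"
    using quot_cross[of p c q] by (simp add: algebra_simps)
  finally show ?thesis using assms by (simp add: add_divide_distrib)
qed

text \<open>
  Cross-multiplying, each claim compares the same quantity \<open>3 (p + 1) (a - c)\<close> with 0. It vanishes
  at \<open>p = -1\<close>, where numerator and denominator are both \<open>-2 (1 - c)\<close> and the quotients below are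
  constant. Absolute values let one statement serve both signs of \<open>p\<close>.
\<close>

lemma abs_weight_le:
  assumes "p \<le> -1 \<or> 0 \<le> p" "0 < a" "a < c" "c < 1"
  shows "(1 - c) / \<bar>quot_den p c\<bar> \<le> (1 - a) / \<bar>quot_den p a\<bar>" (is ?D)
    and "(1 - c) / \<bar>quot_num p c\<bar> \<le> (1 - a) / \<bar>quot_num p a\<bar>" (is ?N)
    and "p \<noteq> -1 \<Longrightarrow> (1 - c) / \<bar>quot_den p c\<bar> < (1 - a) / \<bar>quot_den p a\<bar>"
    and "p \<noteq> -1 \<Longrightarrow> (1 - c) / \<bar>quot_num p c\<bar> < (1 - a) / \<bar>quot_num p a\<bar>"
proof -
  have den: "(1 - c) * quot_den p a - (1 - a) * quot_den p c = 3 * ((p + 1) * (a - c))"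
    unfolding quot_den_def by (simp add: algebra_simps)
  have num: "(1 - c) * quot_num p a - (1 - a) * quot_num p c = 3 * ((p + 1) * (a - c))"
    unfolding quot_num_def by (simp add: algebra_simps)
  have le: "0 \<le> p \<Longrightarrow> (p + 1) * (a - c) < 0" "p \<le> -1 \<Longrightarrow> 0 \<le> (p + 1) * (a - c)"
    "p < -1 \<Longrightarrow> 0 < (p + 1) * (a - c)"
    using assms by (auto simp: mult_pos_neg mult_nonpos_nonpos mult_neg_neg)
  consider "0 \<le> p" | "p \<le> -1" using assms by blast
  then have "?D \<and> ?N \<and> (p \<noteq> -1 \<longrightarrow> (1 - c) / \<bar>quot_den p c\<bar> < (1 - a) / \<bar>quot_den p a\<bar>
     \<and> (1 - c) / \<bar>quot_num p c\<bar> < (1 - a) / \<bar>quot_num p a\<bar>)"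
  proof cases
    case 1
    then show ?thesis
      using quot_pos[of p a] quot_pos[of p c] den num le(1) assms
      by (simp add: divide_simps)
  next
    case 2
    have flip: "(a - 1) * y = - ((1 - a) * y)" for y
      by (simp add: algebra_simps)
    show ?thesis
      using 2 quot_neg[of p a] quot_neg[of p c] den num le(2,3) assms
      by (auto simp: divide_simps flip)
  qed
  then show ?D ?N
    "p \<noteq> -1 \<Longrightarrow> (1 - c) / \<bar>quot_den p c\<bar> < (1 - a) / \<bar>quot_den p a\<bar>"
    "p \<noteq> -1 \<Longrightarrow> (1 - c) / \<bar>quot_num p c\<bar> < (1 - a) / \<bar>quot_num p a\<bar>"
    by blast+
qed

text \<open>
  Distinct parameters cannot both be \<open>-1\<close>, so at least one of the two factors decreases strictly.
\<close>

lemma abs_weight_strict: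
  assumes "p \<le> -1 \<or> 0 \<le> p" "q \<le> -1 \<or> 0 \<le> q" "p \<noteq> q" "0 < a" "a < c" "c < 1"
  shows "(1 - c)\<^sup>2 / (\<bar>quot_den p c\<bar> * \<bar>quot_num q c\<bar>)
           < (1 - a)\<^sup>2 / (\<bar>quot_den p a\<bar> * \<bar>quot_num q a\<bar>)"
proof -
  have nz: "quot_den p c \<noteq> 0" "quot_num q c \<noteq> 0"
    using assms quot_pos[of p c] quot_neg[of p c] quot_pos[of q c] quot_neg[of q c] by force+
  have pos: "0 < (1 - c) / \<bar>quot_den p c\<bar>" "0 < (1 - c) / \<bar>quot_num q c\<bar>"
    using nz assms by simp_all
  note le = abs_weight_le(1)[of p a c] abs_weight_le(2)[of q a c]
  note less = abs_weight_le(3)[of p a c] abs_weight_le(4)[of q a c]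
  have "(1 - c) / \<bar>quot_den p c\<bar> * ((1 - c) / \<bar>quot_num q c\<bar>)
          < (1 - a) / \<bar>quot_den p a\<bar> * ((1 - a) / \<bar>quot_num q a\<bar>)"
  \<comment> \<open>For \<open>p = -1\<close> the strict factor is the one of \<open>q\<close>, otherwise it is the one of \<open>p\<close>.\<close>
  proof (cases "p = -1")
    case True
    then show ?thesis using le less assms pos by (intro mult_le_less_imp_less) auto
  next
    case False
    then show ?thesis using le less assms pos by (intro mult_less_le_imp_less) auto
  qed
  then show ?thesis by (simp add: power2_eq_square)
qed

section \<open>Monotonicity in the parameter\<close>

text \<open>
  When \<open>p\<close> and \<open>q\<close> lie in the same interval the fraction in \<open>cos_quot_ratio\<close> is positive,
  hence decreasing in \<open>c\<close>.
\<close>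

lemma cos_quot_normalized_mono:
  assumes "0 < a" "a < c" "c < 1" "p < q" "q \<le> -1 \<or> 0 \<le> p"
  shows "cos_quot p c / cos_quot p a < cos_quot q c / cos_quot q a"
proof -
  have same_sign: "\<bar>quot_den p x\<bar> * \<bar>quot_num q x\<bar> = quot_den p x * quot_num q x"
    "quot_den p x \<noteq> 0" "quot_den q x \<noteq> 0" "quot_num q x \<noteq> 0" if "0 < x" "x < 1" for x
    using assms that quot_pos[of p x] quot_neg[of p x] quot_pos[of q x] quot_neg[of q x]
    by (auto simp: abs_if)
  have "(1 - c)\<^sup>2 / (quot_den p c * quot_num q c) < (1 - a)\<^sup>2 / (quot_den p a * quot_num q a)"
    using abs_weight_strict[of p q a c] same_sign(1)[of a] same_sign(1)[of c] assms by auto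
  then have "2 * (q - p) * ((1 - c)\<^sup>2 / (quot_den p c * quot_num q c))
      < 2 * (q - p) * ((1 - a)\<^sup>2 / (quot_den p a * quot_num q a))"
    using assms by (intro mult_strict_left_mono) auto
  then have "cos_quot p c / cos_quot q c < cos_quot p a / cos_quot q a"
    using cos_quot_ratio[of p c q] cos_quot_ratio[of p a q] same_sign(2-4)[of a]
      same_sign(2-4)[of c] assms by linarith
  moreover have "0 < cos_quot p a" "0 < cos_quot p c" "0 < cos_quot q a" "0 < cos_quot q c"
    using assms by (auto intro!: cos_quot_pos)
  ultimately show ?thesis by (simp add: divide_simps mult.commute)
qed

text \<open>
  When \<open>p\<close> and \<open>q\<close> lie on different sides the fraction is negative, hence increasing in \<open>c\<close>, and
  the order is reversed: normalized quotients grow from \<open>q\<close> through infinity to \<open>p\<close>.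
\<close>

lemma cos_quot_normalized_wrap:
  assumes "0 < a" "a < c" "c < 1" "p \<le> -1" "0 \<le> q"
  shows "cos_quot q c / cos_quot q a < cos_quot p c / cos_quot p a"
proof -
  have opposite_sign: "\<bar>quot_den p x\<bar> * \<bar>quot_num q x\<bar> = - (quot_den p x * quot_num q x)"
    "quot_den p x \<noteq> 0" "quot_den q x \<noteq> 0" "quot_num q x \<noteq> 0" if "0 < x" "x < 1" for x
    using assms that quot_neg[of p x] quot_pos[of q x]
    by (auto simp: abs_if)
  have "(1 - a)\<^sup>2 / (quot_den p a * quot_num q a) < (1 - c)\<^sup>2 / (quot_den p c * quot_num q c)"
    using abs_weight_strict[of p q a c] opposite_sign[of a] opposite_sign[of c] assms by simp
  then have "2 * (q - p) * ((1 - a)\<^sup>2 / (quot_den p a * quot_num q a))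
      < 2 * (q - p) * ((1 - c)\<^sup>2 / (quot_den p c * quot_num q c))"
    using assms by (intro mult_strict_left_mono) auto
  then have "cos_quot p a / cos_quot q a < cos_quot p c / cos_quot q c"
    using cos_quot_ratio[of p c q] cos_quot_ratio[of p a q] opposite_sign(2-4)[of a]
      opposite_sign(2-4)[of c] assms by linarith
  moreover have "0 < cos_quot p a" "0 < cos_quot p c" "0 < cos_quot q a" "0 < cos_quot q c"
    using assms by (auto intro!: cos_quot_pos)
  ultimately show ?thesis by (simp add: divide_simps mult.commute)
qed

lemma cos_quot_less_iff:
  assumes "p \<le> -1 \<or> 0 \<le> p" "q \<le> -1 \<or> 0 \<le> q" "0 < c" "c < 1"
  shows "cos_quot p c < cos_quot q c \<longleftrightarrow> 0 < (p - q) * (quot_den p c * quot_den q c)"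
proof -
  have nz: "quot_den p c \<noteq> 0" "quot_den q c \<noteq> 0"
    using assms quot_pos[of p c] quot_neg[of p c] quot_pos[of q c] quot_neg[of q c] by force+
  have "cos_quot q c - cos_quot p c
          = 2 * (1 - c)\<^sup>2 * ((p - q) / (quot_den p c * quot_den q c))"
    using quot_cross[of q c p] nz by (simp add: cos_quot_def diff_frac_eq ac_simps)
  moreover have "0 < 2 * (1 - c)\<^sup>2" using assms by simp
  ultimately have "0 < cos_quot q c - cos_quot p c
          \<longleftrightarrow> 0 < (p - q) / (quot_den p c * quot_den q c)"
    by (metis mult_pos_pos zero_less_mult_pos)
  then show ?thesis by (simp add: zero_less_divide_iff zero_less_mult_iff)
qed

lemma cos_quot_antimono:
  assumes "0 < c" "c < 1" "p < q" "q \<le> -1 \<or> 0 \<le> p"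
  shows "cos_quot q c < cos_quot p c"
proof -
  have "0 < quot_den q c * quot_den p c"
    using assms quot_pos[of p c] quot_neg[of p c] quot_pos[of q c] quot_neg[of q c]
    by (auto simp: zero_less_mult_iff)
  then show ?thesis using cos_quot_less_iff[of q p c] assms by auto
qed

lemma cos_quot_wrap:
  assumes "0 < c" "c < 1" "p \<le> -1" "0 \<le> q"
  shows "cos_quot p c < cos_quot q c"
proof -
  have "quot_den p c * quot_den q c < 0"
    using assms quot_neg[of p c] quot_pos[of q c] by (simp add: mult_neg_pos)
  then show ?thesis using cos_quot_less_iff[of p q c] assms by (simp add: mult_neg_neg)
qed

section \<open>The quotient as a function of the half angle\<close>

lemma cos_quarter_range:
  assumes "0 < t" "t < pi / 4"
  shows "cos (pi / 4) < cos t" "cos t < 1" "0 < sin t"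
proof -
  show "cos (pi / 4) < cos t" using assms by (intro cos_monotone_0_pi) auto
  show "cos t < 1" using assms cos_monotone_0_pi[of 0 t] by simp
  show "0 < sin t" using assms by (intro sin_gt_zero) auto
qed

lemma cos_quarter_pos: "0 < cos (pi / 4)" "cos (pi / 4) < 1"
  by (simp_all add: cos_45 real_less_lsqrt)

lemma cos_pos_first_quarter: "0 < cos u" if "0 \<le> u" "u \<le> pi / 4"
proof (rule cos_gt_zero_pi)
  show "- (pi / 2) < u" "u < pi / 2" using that pi_gt_zero by linarith+
qed

lemma half_quot_less_iff:
  assumes "0 < t" "t < pi / 4"
  shows "half_quot p t < half_quot q t \<longleftrightarrow> cos_quot p (cos t) < cos_quot q (cos t)"
  using cos_quarter_range[OF assms] by (simp add: half_quot_def)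

lemma normalized_quot_eq:
  "normalized_quot p t
     = sin t / sin (pi / 4) * (cos_quot p (cos t) / cos_quot p (cos (pi / 4)))"
  by (simp add: normalized_quot_def half_quot_def)

lemma normalized_quot_less_iff:
  assumes "0 < t" "t < pi / 4"
  shows "normalized_quot p t < normalized_quot q t \<longleftrightarrow>
    cos_quot p (cos t) / cos_quot p (cos (pi / 4)) < cos_quot q (cos t) / cos_quot q (cos (pi / 4))"
proof -
  have "0 < sin t / sin (pi / 4)"
    using cos_quarter_range[OF assms] by (simp add: sin_45)
  then show ?thesis unfolding normalized_quot_eq by (simp only: mult_less_cancel_left_pos)
qed

text \<open>
  The amount by which the slope of \<open>half_quot p\<close> exceeds 1 where the cosine is \<open>c\<close>.
\<close>

definition slope_excess :: "real \<Rightarrow> real \<Rightarrow> real" where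
  "slope_excess p c = (1 - c)\<^sup>2 * (2 * (p + 3) * c - p\<^sup>2 + 6 * p + 3) / (quot_den p c)\<^sup>2"

text \<open>
  Over the squared denominator, the derivative minus 1 has a cubic in \<open>cos t\<close> as numerator, with a
  double root at 1; only the linear cofactor can change sign.
\<close>

lemma half_quot_has_derivative:
  assumes "quot_den p (cos t) \<noteq> 0"
  shows "(half_quot p has_real_derivative
    1 + slope_excess p (cos t)) (at t)"
proof -
  let ?c = "cos t" and ?s = "sin t"
  let ?N = "quot_num p (cos t)" and ?D = "quot_den p (cos t)"
  have s2: "?s * ?s = 1 - ?c * ?c"
    using sin_cos_squared_add[of t] by (simp add: power2_eq_square algebra_simps)
  have raw: "(half_quot p has_real_derivative
      ((?c * ?N - 2 * (?s * ?s)) * ?D + (?s * ?s) * (p + 3) * ?N) / ?D\<^sup>2) (at t)"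
    unfolding half_quot_def cos_quot_def
    using assms unfolding quot_num_def quot_den_def
    by (auto intro!: derivative_eq_intros simp: field_simps power2_eq_square)
  have "(?c * ?N - 2 * (?s * ?s)) * ?D + (?s * ?s) * (p + 3) * ?N
      = ?D\<^sup>2 + (1 - ?c)\<^sup>2 * (2 * (p + 3) * ?c - p\<^sup>2 + 6 * p + 3)"
    unfolding s2 quot_num_def quot_den_def by (simp add: algebra_simps power2_eq_square)
  then show ?thesis using raw assms by (simp add: add_divide_distrib slope_excess_def)
qed

lemma half_quot_mvt:
  assumes "0 \<le> p" "0 < t" "t \<le> pi / 4"
  obtains u where "0 < u" "u < t"
    "half_quot p t = t * (1 + slope_excess p (cos u))"
proof -
  have "quot_den p (cos u) \<noteq> 0" if "0 \<le> u" "u \<le> t" for u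
    using quot_pos[of p "cos u"] cos_pos_first_quarter[of u] assms that by simp
  from MVT2[OF assms(2) half_quot_has_derivative[OF this]]
  show ?thesis using that by (auto simp: half_quot_def)
qed

section \<open>Comparison with the diagonal\<close>

lemma half_quot_gt:
  assumes "0 \<le> p" "0 < t" "t \<le> pi / 4"
    and "\<And>u. 0 < u \<Longrightarrow> u < t \<Longrightarrow> 0 < 2 * (p + 3) * cos u - p\<^sup>2 + 6 * p + 3"
  shows "t < half_quot p t"
proof -
  obtain u where u: "0 < u" "u < t" and eq:
    "half_quot p t = t * (1 + slope_excess p (cos u))"
    using half_quot_mvt assms by metis
  have "cos u < 1" "0 < quot_den p (cos u)"
    using cos_quarter_range[of u] cos_quarter_pos quot_pos[of p "cos u"] u assms by auto
  then show ?thesis unfolding eq slope_excess_def using assms(4)[OF u] assms(2) by simp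
qed

text \<open>
  At \<open>p = 9\<close> the linear factor of the excess also vanishes at \<open>c = 1\<close>, which leaves a cube.
\<close>

lemma slope_excess_nine: "slope_excess 9 c = - 24 * (((1 - c) / quot_den 9 c)\<^sup>2 * (1 - c))"
proof -
  have "2 * (9 + 3) * c - 9\<^sup>2 + 6 * 9 + 3 = - 24 * (1 - c)" by simp
  moreover have "x * (- 24 * y) / d = - 24 * (x / d * y)" for x y d :: real by simp
  ultimately show ?thesis by (simp only: slope_excess_def power_divide)
qed

lemma half_quot_nine_less:
  assumes "0 < t" "t \<le> pi / 4"
  shows "half_quot 9 t < t"
proof -
  obtain u where u: "0 < u" "u < t" and eq: "half_quot 9 t = t * (1 + slope_excess 9 (cos u))"
    using half_quot_mvt[of 9 t] assms by auto
  have c: "cos u < 1" "0 < quot_den 9 (cos u)"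
    using cos_quarter_range[of u] cos_quarter_pos quot_pos[of 9 "cos u"] u assms by auto
  then have "0 < ((1 - cos u) / quot_den 9 (cos u))\<^sup>2 * (1 - cos u)" by simp
  then have "slope_excess 9 (cos u) < 0" unfolding slope_excess_nine by linarith
  then show ?thesis unfolding eq using assms(1) by simp
qed

section \<open>Concavity at 9 and convexity below\<close>

text \<open>
  The mean slope over \<open>[0, t]\<close> is a value of the derivative to the left of \<open>t\<close>, the one over
  \<open>[t, b]\<close> a value to the right, and the slope over \<open>[0, b]\<close> is a weighted mean of the two.
\<close>

lemma slope_less_if_deriv_strict_mono:
  fixes f f' :: "real \<Rightarrow> real"
  assumes "f 0 = 0" "0 < t" "t < b"
    and deriv: "\<And>x. 0 \<le> x \<Longrightarrow> x \<le> b \<Longrightarrow> (f has_real_derivative f' x) (at x)"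
    and mono: "\<And>x y. 0 < x \<Longrightarrow> x < y \<Longrightarrow> y < b \<Longrightarrow> f' x < f' y"
  shows "f t / t < f b / b"
proof -
  obtain u where u: "0 < u" "u < t" "f t - f 0 = (t - 0) * f' u"
    using MVT2[of 0 t f f'] assms by auto
  obtain v where v: "t < v" "v < b" "f b - f t = (b - t) * f' v"
    using MVT2[of t b f f'] assms by auto
  have "t * (b - t) * f' u < t * (b - t) * f' v"
    using mono[of u v] u v assms by simp
  moreover have "t * (b - t) * f' u = f t * (b - t)" "t * (b - t) * f' v = t * (f b - f t)"
    using u v assms(1) by simp_all
  ultimately have "f t * b < f b * t"
    by (simp add: algebra_simps)
  then show ?thesis using assms by (simp add: divide_simps)
qed

lemma slope_excess_nine_mono:
  assumes "0 < a" "a < c" "c < 1"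
  shows "slope_excess 9 a < slope_excess 9 c"
proof -
  have "(1 - c) / quot_den 9 c < (1 - a) / quot_den 9 a"
    using abs_weight_le(3)[of 9 a c] quot_pos[of 9 a] quot_pos[of 9 c] assms by simp
  moreover have "0 < (1 - c) / quot_den 9 c" using quot_pos[of 9 c] assms by simp
  ultimately have "((1 - c) / quot_den 9 c)\<^sup>2 * (1 - c) < ((1 - a) / quot_den 9 a)\<^sup>2 * (1 - a)"
    using assms by (intro mult_strict_mono' power_strict_mono) auto
  then show ?thesis unfolding slope_excess_nine by linarith
qed

text \<open>
  Write \<open>k = 6 p + 3 - p^2\<close> for the constant term of the linear factor. The polynomial
  \<open>(1 - c) (2 (p + 3) c + k)\<close> decreases for \<open>c \<ge> 1/2\<close> when \<open>k \<ge> 0\<close>, since its vertex then lies at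
  or to the left of \<open>1/2\<close>; the remaining factor \<open>1 - c\<close> over the squared denominator decreases too.
\<close>

lemma slope_excess_strict_antimono:
  assumes "0 \<le> p" "0 \<le> 6 * p + 3 - p\<^sup>2" "1 / 2 \<le> a" "a < c" "c < 1"
  shows "slope_excess p c < slope_excess p a"
proof -
  define k where "k = 6 * p + 3 - p\<^sup>2"
  have k: "2 * (p + 3) * x - p\<^sup>2 + 6 * p + 3 = 2 * (p + 3) * x + k" for x
    by (simp add: k_def)
  have den: "0 < quot_den p c" "quot_den p c > quot_den p a" "0 < quot_den p a"
    using quot_pos[of p a] quot_pos[of p c] assms by (auto simp: quot_den_def)
  have w: "(1 - c) / (quot_den p c)\<^sup>2 < (1 - a) / (quot_den p a)\<^sup>2"
    using den assms by (intro frac_less power_strict_mono) auto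
  have "(1 - a) * (2 * (p + 3) * a + k) - (1 - c) * (2 * (p + 3) * c + k)
        = (c - a) * (2 * (p + 3) * (a + c - 1) + k)"
    by (simp add: algebra_simps)
  moreover have "0 < 2 * (p + 3) * (a + c - 1)" "0 \<le> k"
    using assms by (simp_all add: k_def)
  then have "0 < (c - a) * (2 * (p + 3) * (a + c - 1) + k)"
    using assms(4) by (intro mult_pos_pos add_pos_nonneg[OF \<open>0 < 2 * (p + 3) * (a + c - 1)\<close>]) auto
  ultimately have v: "(1 - c) * (2 * (p + 3) * c + k) < (1 - a) * (2 * (p + 3) * a + k)"
    by linarith
  have pos: "0 \<le> (1 - c) * (2 * (p + 3) * c + k)"
    using assms by (intro mult_nonneg_nonneg add_nonneg_nonneg) (auto simp: k_def)
  have "(1 - c) / (quot_den p c)\<^sup>2 * ((1 - c) * (2 * (p + 3) * c + k))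
      < (1 - a) / (quot_den p a)\<^sup>2 * ((1 - a) * (2 * (p + 3) * a + k))"
    by (rule mult_strict_mono[OF w v _ pos]) (use den assms in simp)
  then show ?thesis unfolding slope_excess_def k by (simp add: power2_eq_square mult_ac)
qed


text \<open>
  The slope criterion applies to \<open>- half_quot 9\<close>, because \<open>half_quot 9\<close> is concave.
\<close>

lemma normalized_quot_nine_gt:
  assumes "0 < t" "t < pi / 4"
  shows "t / (pi / 4) < normalized_quot 9 t"
proof -
  have den: "0 < quot_den 9 (cos u)" if "0 \<le> u" "u \<le> pi / 4" for u
    using quot_pos[of 9 "cos u"] cos_pos_first_quarter[OF that] by simp
  have "- half_quot 9 t / t < - half_quot 9 (pi / 4) / (pi / 4)"
  proof (rule slope_less_if_deriv_strict_mono[where f' = "\<lambda>u. - (1 + slope_excess 9 (cos u))"])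
    show "((\<lambda>u. - half_quot 9 u) has_real_derivative - (1 + slope_excess 9 (cos u))) (at u)"
      if "0 \<le> u" "u \<le> pi / 4" for u
      using half_quot_has_derivative[of 9 u] den[OF that]
      by (intro DERIV_minus) simp
    show "- (1 + slope_excess 9 (cos u)) < - (1 + slope_excess 9 (cos v))"
      if "0 < u" "u < v" "v < pi / 4" for u v
    proof -
      have "cos v < cos u" using that by (intro cos_monotone_0_pi) auto
      moreover have "cos u < 1" "0 < cos v" using cos_quarter_range[of u]
        cos_quarter_range[of v] cos_quarter_pos that by auto
      ultimately show ?thesis
        using slope_excess_nine_mono[of "cos v" "cos u"] by simp
    qed
  qed (use assms in \<open>simp_all add: half_quot_def\<close>)
  moreover have "0 < half_quot 9 (pi / 4)"
    using cos_quot_pos[of 9 "cos (pi / 4)"] cos_quarter_pos by (simp add: half_quot_def sin_45)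
  ultimately show ?thesis
    using assms by (simp add: normalized_quot_def divide_simps mult_ac)
qed

text \<open>
  Since \<open>cos (pi / 4) \<ge> 1/2\<close>, the excess increases in the angle on the whole interval, so
  \<open>half_quot p\<close> is convex there.
\<close>

lemma normalized_quot_less:
  assumes "0 \<le> p" "0 \<le> 6 * p + 3 - p\<^sup>2" "0 < t" "t < pi / 4"
  shows "normalized_quot p t < t / (pi / 4)"
proof -
  have den: "0 < quot_den p (cos u)" if "0 \<le> u" "u \<le> pi / 4" for u
    using quot_pos[of p "cos u"] cos_pos_first_quarter[OF that] assms by simp
  have half: "1 / 2 \<le> cos (pi / 4)"
    by (simp add: cos_45)
  have "half_quot p t / t < half_quot p (pi / 4) / (pi / 4)"
  proof (rule slope_less_if_deriv_strict_mono[where f' = "\<lambda>u. 1 + slope_excess p (cos u)"])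
    show "(half_quot p has_real_derivative 1 + slope_excess p (cos u)) (at u)" if "0 \<le> u" "u \<le> pi / 4" for u
      using half_quot_has_derivative[of p u] den[OF that] by simp
    show "1 + slope_excess p (cos u) < 1 + slope_excess p (cos v)"
      if "0 < u" "u < v" "v < pi / 4" for u v
    proof -
      have "cos v < cos u" using that by (intro cos_monotone_0_pi) auto
      moreover have "cos u < 1" "1 / 2 \<le> cos v" using cos_quarter_range[of u]
        cos_quarter_range[of v] half that by auto
      ultimately show ?thesis
        using slope_excess_strict_antimono[of p "cos v" "cos u"] assms by simp
    qed
  qed (use assms in \<open>simp_all add: half_quot_def\<close>)
  moreover have "0 < half_quot p (pi / 4)"
    using cos_quot_pos[of p "cos (pi / 4)"] cos_quarter_pos assms
    by (simp add: half_quot_def sin_45)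
  ultimately show ?thesis
    using assms by (simp add: normalized_quot_def divide_simps mult_ac)
qed

section \<open>The substitution by the double angle\<close>

lemma arcsin_quot_sin_double:
  assumes "0 \<le> t" "t \<le> pi / 4"
  shows "arcsin_quot p (sin (2 * t)) = half_quot p t"
proof -
  have le: "sin t \<le> cos t"
  proof -
    have "cos (pi / 2 - t) \<le> cos t" using assms by (intro cos_monotone_0_pi_le) auto
    then show ?thesis by (simp add: cos_diff)
  qed
  have nonneg: "0 \<le> sin t" "0 \<le> cos t"
    using assms by (auto intro!: sin_ge_zero cos_ge_zero)
  have sq: "1 + sin (2 * t) = (cos t + sin t)\<^sup>2" "1 - sin (2 * t) = (cos t - sin t)\<^sup>2"
    using sin_cos_squared_add[of t] by (auto simp: sin_double power2_sum power2_diff)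
  have "sqrt (1 + sin (2 * t)) = cos t + sin t" "sqrt (1 - sin (2 * t)) = cos t - sin t"
    unfolding sq using le nonneg by simp_all
  then have "arcsin_quot p (sin (2 * t))
      = ((3 * p + 1) * (2 * sin t) + 2 * (2 * sin t * cos t)) / (4 * p + (p + 3) * (2 * cos t))"
    unfolding arcsin_quot_def by (simp add: sin_double)
  also have "(3 * p + 1) * (2 * sin t) + 2 * (2 * sin t * cos t) = 2 * (sin t * quot_num p (cos t))"
    by (simp add: quot_num_def algebra_simps)
  also have "4 * p + (p + 3) * (2 * cos t) = 2 * quot_den p (cos t)"
    by (simp add: quot_den_def algebra_simps)
  finally show ?thesis by (simp add: half_quot_def cos_quot_def)
qed

lemma sigma_eq: "sigma p = half_quot p (pi / 4) / (pi / 4)"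
proof -
  have "half_quot p (pi / 4)
      = (sqrt 2 / 2 * (3 * p + sqrt 2 + 1)) / (sqrt 2 / 2 * ((2 * sqrt 2 + 1) * p + 3))"
    by (simp add: half_quot_def cos_quot_def quot_num_def quot_den_def sin_45 cos_45 algebra_simps)
  also have "\<dots> = (3 * p + sqrt 2 + 1) / ((2 * sqrt 2 + 1) * p + 3)"
    by (rule mult_divide_mult_cancel_left) simp
  finally have *: "half_quot p (pi / 4) = (3 * p + sqrt 2 + 1) / ((2 * sqrt 2 + 1) * p + 3)" .
  have "4 / pi * y = y / (pi / 4)" for y by simp
  then show ?thesis unfolding sigma_def * by blast
qed

lemma arcsin_quot_bounds_iff:
  assumes "0 < t" "t < pi / 4"
  shows "arcsin (sin (2 * t)) = 2 * t"
    and "2 * arcsin_quot p (sin (2 * t)) = 2 * half_quot p t"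
    and "2 / sigma p * arcsin_quot p (sin (2 * t)) = pi / 2 * normalized_quot p t"
  using assms
  by (simp_all add: arcsin_sin arcsin_quot_sin_double sigma_eq normalized_quot_def)

lemma ball_unit_interval_iff:
  "(\<forall>x\<in>{0<..<1}. P x) \<longleftrightarrow> (\<forall>t. 0 < t \<and> t < pi / 4 \<longrightarrow> P (sin (2 * t)))"
proof safe
  fix t :: real
  assume P: "\<forall>x\<in>{0<..<1}. P x" and t: "0 < t" "t < pi / 4"
  have "sin (2 * t) < sin (pi / 2)" using t by (intro sin_monotone_2pi) auto
  moreover have "0 < sin (2 * t)" using t by (intro sin_gt_zero) auto
  ultimately show "P (sin (2 * t))" using P by simp
next
  fix x :: real
  assume P: "\<forall>t. 0 < t \<and> t < pi / 4 \<longrightarrow> P (sin (2 * t))" and x: "x \<in> {0<..<1}"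
  have "arcsin 0 < arcsin x" by (rule arcsin_less_arcsin) (use x in auto)
  moreover have "arcsin x < arcsin 1" by (rule arcsin_less_arcsin) (use x in auto)
  ultimately have "0 < arcsin x / 2" "arcsin x / 2 < pi / 4" by auto
  then have "P (sin (2 * (arcsin x / 2)))" using P by blast
  then show "P x" using x by simp
qed

section \<open>The bounds\<close>

lemma p1_approx: "\<bar>p1 - 6.343\<bar> < 0.0005"
proof -
  have pi: "3.14159 < pi" "pi < 3.1416" using pi_approx by auto
  have "4.4552 < sqrt (6 * pi + 1)" using pi by (intro real_less_rsqrt) (simp add: power2_eq_square)
  moreover have "sqrt (6 * pi + 1) < 4.4554" using pi by (intro real_less_lsqrt) (simp_all add: power2_eq_square)
  ultimately have "12685 / 2000 * (12 - 3 * pi) < 2 * sqrt (6 * pi + 1) + 3 * pi - 2"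
    "2 * sqrt (6 * pi + 1) + 3 * pi - 2 < 12687 / 2000 * (12 - 3 * pi)"
    using pi by auto
  moreover have "0 < 12 - 3 * pi" using pi by simp
  ultimately have "12685 / 2000 < p1" "p1 < 12687 / 2000"
    unfolding p1_def by (metis pos_less_divide_eq, metis pos_divide_less_eq)
  then show ?thesis unfolding abs_less_iff by auto
qed

text \<open>
  Moving the parameter upward from 9, and on through infinity to \<open>p \<le> -1\<close>, lowers the lower bound
  and raises the upper one, so the value 9 is the extreme case.
\<close>

lemma bounds_strict:
  assumes "p \<le> -1 \<or> 9 \<le> p" "0 < t" "t < pi / 4"
  shows "half_quot p t < t" and "t / (pi / 4) < normalized_quot p t"
proof -
  note c = cos_quarter_range[OF assms(2,3)] cos_quarter_pos
  note iff = half_quot_less_iff[OF assms(2,3), of p 9] normalized_quot_less_iff[OF assms(2,3), of 9 p]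
  have "half_quot p t < half_quot 9 t \<and> normalized_quot 9 t < normalized_quot p t \<or> p = 9"
  proof -
    consider "p \<le> -1" | "p = 9" | "9 < p" using assms(1) by linarith
    then show ?thesis
    proof cases
      case 1
      then show ?thesis unfolding iff
        using cos_quot_wrap[of "cos t" p 9]
          cos_quot_normalized_wrap[of "cos (pi / 4)" "cos t" p 9] c by auto
    next
      case 3
      then show ?thesis unfolding iff
        using cos_quot_antimono[of "cos t" 9 p]
          cos_quot_normalized_mono[of "cos (pi / 4)" "cos t" 9 p] c by auto
    qed simp
  qed
  then show "half_quot p t < t" "t / (pi / 4) < normalized_quot p t"
    using half_quot_nine_less[of t] normalized_quot_nine_gt[of t] assms by auto
qed

text \<open>
  For \<open>p \<ge> 0\<close>, convexity holds as long as \<open>p^2 \<le> 6 p + 3\<close>, that is \<open>p \<le> 3 + 2 sqrt 3\<close>. This number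
  is about 6.46 and so exceeds \<open>p1\<close>; the rational value \<open>32/5\<close> separates the two.
\<close>

lemma bounds_reversed:
  assumes "0 \<le> p" "p \<le> p1" "0 < t" "t < pi / 4"
  shows "t < half_quot p t" and "normalized_quot p t < t / (pi / 4)"
proof -
  have "p \<le> 32 / 5" using assms(2) p1_approx by (simp add: abs_if split: if_splits)
  then have "p * (p - 2 / 5) \<le> p * 6" using assms(1) by (intro mult_left_mono) auto
  then have crit: "0 \<le> 6 * p + 3 - p\<^sup>2"
    using \<open>p \<le> 32 / 5\<close> by (simp add: power2_eq_square algebra_simps)
  show "normalized_quot p t < t / (pi / 4)" using normalized_quot_less crit assms by blast
  show "t < half_quot p t"
  proof (rule half_quot_gt)
    fix u :: real assume "0 < u" "u < t"
    then have "0 < 2 * (p + 3) * cos u"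
      using assms cos_quarter_range[of u] cos_quarter_pos by simp
    then show "0 < 2 * (p + 3) * cos u - p\<^sup>2 + 6 * p + 3" using crit by linarith
  qed (use assms in auto)
qed

text \<open>
  At \<open>c = 1\<close> the linear factor of the slope excess is \<open>(p + 1) (9 - p) > 0\<close>, so by continuity it
  stays positive for small angles, and the quotient rises above the diagonal at once.
\<close>

lemma lower_bound_fails:
  assumes "0 \<le> p" "p < 9"
  shows "\<exists>t. 0 < t \<and> t < pi / 4 \<and> t < half_quot p t"
proof -
  define g where "g u = 2 * (p + 3) * cos u - p\<^sup>2 + 6 * p + 3" for u
  have "g 0 = (p + 1) * (9 - p)" by (simp add: g_def power2_eq_square algebra_simps)
  then have "0 < g 0" using assms by simp
  moreover have "isCont g 0" unfolding g_def by (intro continuous_intros)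
  ultimately have "eventually (\<lambda>u. 0 < g u) (at_right 0)"
    by (intro order_tendstoD(1)[of g "g 0"]) (auto simp: isCont_def intro: tendsto_within_subset)
  then obtain b where b: "0 < b" "\<And>u. 0 < u \<Longrightarrow> u < b \<Longrightarrow> 0 < g u"
    by (auto simp: eventually_at_right[of 0 1])
  define t where "t = min b (pi / 8)"
  have t: "0 < t" "t \<le> b" "t \<le> pi / 8"
    using b(1) by (auto simp: t_def)
  then have "t < pi / 4" using pi_gt_zero by linarith
  moreover have "t < half_quot p t"
    using assms b(2) t \<open>t < pi / 4\<close> by (intro half_quot_gt) (auto simp: g_def)
  ultimately show ?thesis using t by blast
qed

text \<open>
  The bound with constant \<open>sigma p\<close> is an equality at \<open>t = pi / 4\<close>; a larger constant would make
  the limit of the strict inequality false there.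
\<close>

lemma sigma_best:
  assumes "p \<le> -1 \<or> 0 \<le> p" "sigma p < c"
  shows "\<not> (\<forall>t. 0 < t \<and> t < pi / 4 \<longrightarrow> 2 * t < 2 / c * half_quot p t)"
proof
  assume *: "\<forall>t. 0 < t \<and> t < pi / 4 \<longrightarrow> 2 * t < 2 / c * half_quot p t"
  have pos: "0 < half_quot p (pi / 4)"
    using cos_quot_pos[of p "cos (pi / 4)"] cos_quarter_pos assms
    by (simp add: half_quot_def sin_45)
  then have "0 < sigma p" by (simp add: sigma_eq)
  then have c: "0 < c" using assms by simp
  have "quot_den p (cos (pi / 4)) \<noteq> 0"
    using quot_pos[of p "cos (pi / 4)"] quot_neg[of p "cos (pi / 4)"] cos_quarter_pos assms by force
  then have "isCont (half_quot p) (pi / 4)" by (rule DERIV_isCont[OF half_quot_has_derivative])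
  then have "(half_quot p \<longlongrightarrow> half_quot p (pi / 4)) (at_left (pi / 4))"
    by (auto simp: isCont_def intro: tendsto_within_subset)
  then have "((\<lambda>t. 2 / c * half_quot p t) \<longlongrightarrow> 2 / c * half_quot p (pi / 4)) (at_left (pi / 4))"
    by (intro tendsto_intros)
  moreover have "((\<lambda>t. 2 * t) \<longlongrightarrow> 2 * (pi / 4)) (at_left (pi / 4))"
    by (intro tendsto_intros)
  moreover have "eventually (\<lambda>t. 2 * t \<le> 2 / c * half_quot p t) (at_left (pi / 4))"
    using * by (auto simp: eventually_at_left[of 0 "pi / 4"] intro!: exI[of _ 0] less_imp_le)
  ultimately have "2 * (pi / 4) \<le> 2 / c * half_quot p (pi / 4)"
    by (intro tendsto_le[of "at_left (pi / 4)"]) auto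
  then have "c \<le> sigma p" using c by (simp add: sigma_eq field_simps)
  then show False using assms by simp
qed

theorem proposition2:
  fixes p :: real
  assumes "p \<in> {..-1} \<union> {0..}"
  shows
    "((\<forall>x\<in>{0<..<1}. 2 * arcsin_quot p x < arcsin x \<and>
                    arcsin x < 2 / sigma p * arcsin_quot p x)
        \<longleftrightarrow> p \<in> {..-1} \<union> {9..})
     \<and> (p \<in> {..-1} \<union> {9..} \<longrightarrow>
          (\<forall>c>sigma p. \<not> (\<forall>x\<in>{0<..<1}. arcsin x < 2 / c * arcsin_quot p x)))
     \<and> (\<forall>x\<in>{0<..<1}. \<forall>I\<in>{{..-1}, {0<..}}.
          strict_antimono_on I (\<lambda>q. 2 * arcsin_quot q x) \<and>
          strict_mono_on I (\<lambda>q. 2 / sigma q * arcsin_quot q x))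
     \<and> (p \<in> {0..p1} \<longrightarrow>
          (\<forall>x\<in>{0<..<1}. 2 * arcsin_quot p x > arcsin x \<and>
                        arcsin x > 2 / sigma p * arcsin_quot p x))
     \<and> \<bar>p1 - 6.343\<bar> < 0.0005"
proof (intro conjI)
  have upper: "t / (pi / 4) < r \<longleftrightarrow> 2 * t < pi / 2 * r" "r < t / (pi / 4) \<longleftrightarrow> pi / 2 * r < 2 * t"
    for t r :: real
    by (auto simp: field_simps)
  have bounds: "2 * arcsin_quot p (sin (2 * t)) < arcsin (sin (2 * t)) \<longleftrightarrow> half_quot p t < t"
    "arcsin (sin (2 * t)) < 2 / sigma p * arcsin_quot p (sin (2 * t))
       \<longleftrightarrow> t / (pi / 4) < normalized_quot p t"
    "arcsin (sin (2 * t)) < 2 * arcsin_quot p (sin (2 * t)) \<longleftrightarrow> t < half_quot p t"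
    "2 / sigma p * arcsin_quot p (sin (2 * t)) < arcsin (sin (2 * t))
       \<longleftrightarrow> normalized_quot p t < t / (pi / 4)"
    if "0 < t" "t < pi / 4" for t
    unfolding arcsin_quot_bounds_iff[OF that] upper by simp_all
  show "(\<forall>x\<in>{0<..<1}. 2 * arcsin_quot p x < arcsin x \<and>
                    arcsin x < 2 / sigma p * arcsin_quot p x)
        \<longleftrightarrow> p \<in> {..-1} \<union> {9..}" (is "?L \<longleftrightarrow> ?R")
  proof
    assume L: ?L
    show ?R
    proof (rule ccontr)
      assume "\<not> ?R"
      then obtain t where t: "0 < t" "t < pi / 4" "t < half_quot p t"
        using lower_bound_fails[of p] assms by auto
      then have "half_quot p t < t"
        using L bounds(1)[OF t(1,2)] unfolding ball_unit_interval_iff by blast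
      with t show False by simp
    qed
  next
    assume ?R
    then show ?L
      unfolding ball_unit_interval_iff using bounds(1,2) bounds_strict[of p] by auto
  qed
  show "p \<in> {..-1} \<union> {9..} \<longrightarrow>
          (\<forall>c>sigma p. \<not> (\<forall>x\<in>{0<..<1}. arcsin x < 2 / c * arcsin_quot p x))"
  proof (intro impI allI)
    fix c assume "sigma p < c"
    have "arcsin (sin (2 * t)) = 2 * t" "arcsin_quot p (sin (2 * t)) = half_quot p t"
      if "0 < t" "t < pi / 4" for t
      using arcsin_quot_bounds_iff[OF that] by simp_all
    then show "\<not> (\<forall>x\<in>{0<..<1}. arcsin x < 2 / c * arcsin_quot p x)"
      unfolding ball_unit_interval_iff using sigma_best[of p c] \<open>sigma p < c\<close> assms by auto
  qed
  show "\<forall>x\<in>{0<..<1}. \<forall>I\<in>{{..-1}, {0<..}}.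
          strict_antimono_on I (\<lambda>q. 2 * arcsin_quot q x) \<and>
          strict_mono_on I (\<lambda>q. 2 / sigma q * arcsin_quot q x)"
    unfolding ball_unit_interval_iff
  proof (intro allI impI ballI conjI; elim conjE)
    fix t :: real and I :: "real set"
    assume I: "I \<in> {{..-1}, {0<..}}" and t: "0 < t" "t < pi / 4"
    have I_side: "r \<le> -1 \<or> 0 \<le> q" if "q \<in> I" "r \<in> I" for q r
      using I that by auto
    note c = cos_quarter_range[OF t] cos_quarter_pos
    show "strict_antimono_on I (\<lambda>q. 2 * arcsin_quot q (sin (2 * t)))"
      unfolding arcsin_quot_bounds_iff[OF t]
      using I_side c half_quot_less_iff[OF t] cos_quot_antimono[of "cos t"]
      by (intro monotone_onI) auto
    show "strict_mono_on I (\<lambda>q. 2 / sigma q * arcsin_quot q (sin (2 * t)))"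
      unfolding arcsin_quot_bounds_iff[OF t]
      using I_side c normalized_quot_less_iff[OF t]
        cos_quot_normalized_mono[of "cos (pi / 4)" "cos t"]
      by (intro strict_mono_onI) auto
  qed
  show "p \<in> {0..p1} \<longrightarrow>
          (\<forall>x\<in>{0<..<1}. 2 * arcsin_quot p x > arcsin x \<and>
                        arcsin x > 2 / sigma p * arcsin_quot p x)"
    unfolding ball_unit_interval_iff using bounds(3,4) bounds_reversed[of p] by auto
  show "\<bar>p1 - 6.343\<bar> < 0.0005" by (rule p1_approx)
qed

end
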